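(* Let $L$ be a complete algebraic lattice. Then the lattice $a.c.o.(L)$ is algebraic, i.e. every element of $a.c.o.(L)$ is a join (in $a.c.o.(L)$) of compact elements of $a.c.o.(L)$.
   Context: An element $c$ of a complete lattice $M$ is compact if $c\le\bigvee_{i\in I}x_i$ implies $c\le\bigvee_{i\in F}x_i$ for some finite $F\subseteq I$. $C(M)$ denotes the set of compact elements of $M$, and $k\le_c x$ means $k\in C(M)$ and $k\le x$. $M$ is algebraic if every element is a join of compact elements. A closure operator on $L$ is a map $\phi:L\to L$ such that $a\le\phi(a)$, $\phi(\phi(a))=\phi(a)$, and $a\le b$ implies $\phi(a)\le\phi(b)$, for all $a,b\in L$. A map $\phi:L\to L$ is finitary if $\phi(x)=\bigvee_{k\le_c x}\phi(k)$ for all $x\in L$. $a.c.o.(L)$ (the algebraic closure operators) is the set of finitary closure operators on $L$, ordered by $\phi_1\le\phi_2$ iff $\phi_1(x)\le\phi_2(x)$ for all $x\in L$; it is a complete lattice under this order. *)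

theory Defs
  imports "HOL-Algebra.Complete_Lattice"
begin

text \<open>
  All notions are stated for complete lattices given by a carrier, so that the same definitions of
  compactness and algebraicity apply both to a lattice and to its lattice of algebraic closure
  operators.  A family is represented by the set of its members.
\<close>

definition compact_elements :: "('a, 'b) gorder_scheme \<Rightarrow> 'a set" where
  "compact_elements M =
     {c \<in> carrier M. \<forall>X. X \<subseteq> carrier M \<and> c \<sqsubseteq>\<^bsub>M\<^esub> \<Squnion>\<^bsub>M\<^esub>X \<longrightarrow>
        (\<exists>F. finite F \<and> F \<subseteq> X \<and> c \<sqsubseteq>\<^bsub>M\<^esub> \<Squnion>\<^bsub>M\<^esub>F)}"

locale algebraic_lattice = complete_lattice M for M (structure) +
  assumes join_of_compact:
    "x \<in> carrier M \<Longrightarrow> \<exists>K. K \<subseteq> compact_elements M \<and> x = \<Squnion>K"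

definition closure_operator :: "('a, 'b) gorder_scheme \<Rightarrow> ('a \<Rightarrow> 'a) \<Rightarrow> bool" where
  "closure_operator L \<phi> \<longleftrightarrow>
     \<phi> \<in> carrier L \<rightarrow> carrier L \<and>
     (\<forall>a\<in>carrier L. a \<sqsubseteq>\<^bsub>L\<^esub> \<phi> a) \<and>
     (\<forall>a\<in>carrier L. \<phi> (\<phi> a) = \<phi> a) \<and>
     (\<forall>a\<in>carrier L. \<forall>b\<in>carrier L. a \<sqsubseteq>\<^bsub>L\<^esub> b \<longrightarrow> \<phi> a \<sqsubseteq>\<^bsub>L\<^esub> \<phi> b)"

definition finitary :: "('a, 'b) gorder_scheme \<Rightarrow> ('a \<Rightarrow> 'a) \<Rightarrow> bool" where
  "finitary L \<phi> \<longleftrightarrow>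
     (\<forall>x\<in>carrier L. \<phi> x = \<Squnion>\<^bsub>L\<^esub>(\<phi> ` {k \<in> compact_elements L. k \<sqsubseteq>\<^bsub>L\<^esub> x}))"

text \<open>
  Maps \<open>L \<rightarrow> L\<close> are taken to be extensional (\<open>undefined\<close> off the carrier), so that equality of
  elements of \<open>aco L\<close> is equality of maps on the carrier and the pointwise order is antisymmetric.
\<close>

definition aco :: "('a, 'b) gorder_scheme \<Rightarrow> ('a \<Rightarrow> 'a) gorder" where
  "aco L =
     \<lparr>carrier = {\<phi> \<in> carrier L \<rightarrow>\<^sub>E carrier L. closure_operator L \<phi> \<and> finitary L \<phi>},
      eq = (=),
      le = (\<lambda>\<phi> \<psi>. \<forall>x\<in>carrier L. \<phi> x \<sqsubseteq>\<^bsub>L\<^esub> \<psi> x)\<rparr>"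

end

(* The supremum of a set \<Phi> of algebraic closure operators sends x to the least element above x
   that is closed under every member of \<Phi>.  It is finitary because a directed join of elements
   closed under \<Phi> is again closed under \<Phi>.  For a, b compact in L, the operator
   x \<mapsto> (if a \<le> x then x \<squnion> b else x) lies below an algebraic closure operator \<psi> iff
   b \<le> \<psi> a; hence \<psi> is the join of such operators.  They are compact, because
   the directed join of the elements (\<Squnion>F) a, for F ranging over the finite subsets of \<Phi>,
   is closed under \<Phi> and therefore equals (\<Squnion>\<Phi>) a. *)

theory Submission
  imports Defs
begin

section \<open>Directed sets and basic properties of algebraic closure operators\<close>

definition directed_in :: "('a, 'b) gorder_scheme \<Rightarrow> 'a set \<Rightarrow> bool" where
  "directed_in L D \<longleftrightarrow> D \<subseteq> carrier L \<and> D \<noteq> {} \<and>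
     (\<forall>x\<in>D. \<forall>y\<in>D. \<exists>z\<in>D. x \<sqsubseteq>\<^bsub>L\<^esub> z \<and> y \<sqsubseteq>\<^bsub>L\<^esub> z)"

definition compacts_below :: "('a, 'b) gorder_scheme \<Rightarrow> 'a \<Rightarrow> 'a set" where
  "compacts_below L x = {k \<in> compact_elements L. k \<sqsubseteq>\<^bsub>L\<^esub> x}"

text \<open>Being closed under \<phi> is written as an inequality; for extensive \<phi> this makes
  \<open>y\<close> a fixed point, so the value is the meet of the common fixed points above
  \<open>x\<close>. The restriction to the carrier gives the extensionality required in
  \<open>aco\<close>.\<close>

definition aco_sup :: "('a, 'b) gorder_scheme \<Rightarrow> ('a \<Rightarrow> 'a) set \<Rightarrow> 'a \<Rightarrow> 'a" where
  "aco_sup L \<Phi> = (\<lambda>x\<in>carrier L.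
     \<Sqinter>\<^bsub>L\<^esub>{y \<in> carrier L. x \<sqsubseteq>\<^bsub>L\<^esub> y \<and> (\<forall>\<phi>\<in>\<Phi>. \<phi> y \<sqsubseteq>\<^bsub>L\<^esub> y)})"

definition step_operator :: "('a, 'b) gorder_scheme \<Rightarrow> 'a \<Rightarrow> 'a \<Rightarrow> 'a \<Rightarrow> 'a" where
  "step_operator L a b = (\<lambda>x\<in>carrier L. if a \<sqsubseteq>\<^bsub>L\<^esub> x then x \<squnion>\<^bsub>L\<^esub> b else x)"

lemma compact_closed: "k \<in> compact_elements L \<Longrightarrow> k \<in> carrier L"
  by (simp add: compact_elements_def)

lemma compactD:
  assumes "c \<in> compact_elements L" "X \<subseteq> carrier L" "c \<sqsubseteq>\<^bsub>L\<^esub> \<Squnion>\<^bsub>L\<^esub>X"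
  obtains F where "finite F" "F \<subseteq> X" "c \<sqsubseteq>\<^bsub>L\<^esub> \<Squnion>\<^bsub>L\<^esub>F"
  using assms unfolding compact_elements_def by blast

lemma carrier_aco:
  "carrier (aco L) =
     {\<phi> \<in> carrier L \<rightarrow>\<^sub>E carrier L. closure_operator L \<phi> \<and> finitary L \<phi>}"
  by (simp add: aco_def)

lemma le_aco: "\<phi> \<sqsubseteq>\<^bsub>aco L\<^esub> \<psi> \<longleftrightarrow> (\<forall>x\<in>carrier L. \<phi> x \<sqsubseteq>\<^bsub>L\<^esub> \<psi> x)"
  by (simp add: aco_def)

lemma aco_closed: "\<phi> \<in> carrier (aco L) \<Longrightarrow> x \<in> carrier L \<Longrightarrow> \<phi> x \<in> carrier L"
  by (auto simp: carrier_aco)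

lemma aco_extensive: "\<phi> \<in> carrier (aco L) \<Longrightarrow> x \<in> carrier L \<Longrightarrow> x \<sqsubseteq>\<^bsub>L\<^esub> \<phi> x"
  by (auto simp: carrier_aco closure_operator_def)

lemma aco_idem: "\<phi> \<in> carrier (aco L) \<Longrightarrow> x \<in> carrier L \<Longrightarrow> \<phi> (\<phi> x) = \<phi> x"
  by (auto simp: carrier_aco closure_operator_def)

lemma aco_mono:
  "\<phi> \<in> carrier (aco L) \<Longrightarrow> x \<in> carrier L \<Longrightarrow> y \<in> carrier L \<Longrightarrow> x \<sqsubseteq>\<^bsub>L\<^esub> y \<Longrightarrow> \<phi> x \<sqsubseteq>\<^bsub>L\<^esub> \<phi> y"
  by (auto simp: carrier_aco closure_operator_def)

lemma aco_finitary:
  "\<phi> \<in> carrier (aco L) \<Longrightarrow> x \<in> carrier L \<Longrightarrow> \<phi> x = \<Squnion>\<^bsub>L\<^esub>(\<phi> ` compacts_below L x)"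
  by (auto simp: carrier_aco finitary_def compacts_below_def)

section \<open>Compactness and directed sets in a complete lattice\<close>

context complete_lattice
begin

lemma sup_mono:
  assumes "A \<subseteq> B" "B \<subseteq> carrier L"
  shows "\<Squnion>A \<sqsubseteq> \<Squnion>B"
  using assms sup_upper[of B] by (intro sup_least) (simp_all add: subset_iff)

text \<open>Compactness yields a finite subset of \<open>D\<close> whose join is above
  \<open>k\<close>, and directedness gives, by induction, an upper bound of that subset inside
  \<open>D\<close>.\<close>

lemma compact_le_directed_sup:
  assumes k: "k \<in> compact_elements L" and D: "directed_in L D" and le: "k \<sqsubseteq> \<Squnion>D"
  obtains d where "d \<in> D" "k \<sqsubseteq> d"
proof -
  have DL: "D \<subseteq> carrier L" using D by (simp add: directed_in_def)
  obtain F where F: "finite F" "F \<subseteq> D" "k \<sqsubseteq> \<Squnion>F"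
    using compactD[OF k DL le] .
  from F(1,2) have "\<exists>d\<in>D. \<forall>x\<in>F. x \<sqsubseteq> d"
  proof (induction F)
    case empty
    \<comment> \<open>Any element of \<open>D\<close> bounds the empty set, so this case rests on
      \<open>D\<close> being nonempty.\<close>
    then show ?case using D by (auto simp: directed_in_def)
  next
    case (insert x F)
    then obtain d where d: "d \<in> D" "\<forall>y\<in>F. y \<sqsubseteq> d" by auto
    have "\<exists>e\<in>D. x \<sqsubseteq> e \<and> d \<sqsubseteq> e"
      using D d insert.prems by (simp add: directed_in_def)
    then obtain e where e: "e \<in> D" "x \<sqsubseteq> e" "d \<sqsubseteq> e" by blast
    have "y \<sqsubseteq> e" if "y \<in> F" for y
      using le_trans[of y d e] d e that insert.prems DL by blast
    then show ?case using e by blast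
  qed
  then obtain d where d: "d \<in> D" "\<forall>x\<in>F. x \<sqsubseteq> d" by blast
  have FL: "F \<subseteq> carrier L" using F(2) DL by blast
  have dL: "d \<in> carrier L" using d DL by blast
  have "\<Squnion>F \<sqsubseteq> d" using d dL FL by (intro sup_least) auto
  then have "k \<sqsubseteq> d"
    using le_trans[OF F(3)] compact_closed[OF k] FL dL by simp
  with d show thesis using that by blast
qed

lemma bottom_compact: "\<bottom> \<in> compact_elements L"
  unfolding compact_elements_def by (simp add: exI[of _ "{}"] bottom_lower)

text \<open>The union of a finite subfamily covering \<open>a\<close> and one covering
  \<open>b\<close> covers the join.\<close>

lemma join_compact:
  assumes a: "a \<in> compact_elements L" and b: "b \<in> compact_elements L"
  shows "a \<squnion> b \<in> compact_elements L"
proof -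
  have aL: "a \<in> carrier L" and bL: "b \<in> carrier L" using a b by (auto dest: compact_closed)
  have "\<exists>F. finite F \<and> F \<subseteq> X \<and> a \<squnion> b \<sqsubseteq> \<Squnion>F" if X: "X \<subseteq> carrier L" "a \<squnion> b \<sqsubseteq> \<Squnion>X" for X
  proof -
    have sX: "\<Squnion>X \<in> carrier L" using X by simp
    have "a \<sqsubseteq> \<Squnion>X" "b \<sqsubseteq> \<Squnion>X"
      using le_trans[OF join_left X(2)] le_trans[OF join_right X(2)] aL bL sX by auto
    then obtain F G where F: "finite F" "F \<subseteq> X" "a \<sqsubseteq> \<Squnion>F"
      and G: "finite G" "G \<subseteq> X" "b \<sqsubseteq> \<Squnion>G"
      by (meson compactD a b X(1))
    have FG: "F \<union> G \<subseteq> carrier L" using F G X by blast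
    have sub: "F \<subseteq> carrier L" "G \<subseteq> carrier L" using FG by auto
    have "a \<sqsubseteq> \<Squnion>(F \<union> G)"
      using le_trans[OF F(3) sup_mono[of F "F \<union> G"]] FG sub aL by simp
    moreover have "b \<sqsubseteq> \<Squnion>(F \<union> G)"
      using le_trans[OF G(3) sup_mono[of G "F \<union> G"]] FG sub bL by simp
    ultimately have "a \<squnion> b \<sqsubseteq> \<Squnion>(F \<union> G)"
      using FG aL bL by (intro join_le) auto
    then show ?thesis using F G by (intro exI[of _ "F \<union> G"]) auto
  qed
  then show ?thesis using aL bL by (simp add: compact_elements_def)
qed

text \<open>Compact elements are closed under binary joins, which supply upper bounds, and include
  \<bottom>, which makes the set nonempty.\<close>

lemma directed_compacts_below:
  assumes "x \<in> carrier L"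
  shows "directed_in L (compacts_below L x)"
proof -
  have "\<exists>c\<in>compacts_below L x. a \<sqsubseteq> c \<and> b \<sqsubseteq> c"
    if "a \<in> compacts_below L x" "b \<in> compacts_below L x" for a b
    using that assms compact_closed[of a L] compact_closed[of b L]
    by (intro bexI[of _ "a \<squnion> b"])
      (simp_all add: compacts_below_def join_compact join_le join_left join_right)
  moreover have "\<bottom> \<in> compacts_below L x"
    using assms bottom_compact by (simp add: compacts_below_def bottom_lower)
  moreover have "compacts_below L x \<subseteq> carrier L"
    by (auto simp: compacts_below_def dest: compact_closed)
  ultimately show ?thesis unfolding directed_in_def
    by (intro conjI ballI) auto
qed

lemma directed_image:
  assumes D: "directed_in L D" and f: "\<And>x. x \<in> D \<Longrightarrow> f x \<in> carrier L"
    and mono: "\<And>x y. x \<in> D \<Longrightarrow> y \<in> D \<Longrightarrow> x \<sqsubseteq> y \<Longrightarrow> f x \<sqsubseteq> f y"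
  shows "directed_in L (f ` D)"
  unfolding directed_in_def
proof (intro conjI ballI)
  fix u v assume "u \<in> f ` D" "v \<in> f ` D"
  then obtain x y where xy: "u = f x" "x \<in> D" "v = f y" "y \<in> D" by blast
  obtain z where "z \<in> D" "x \<sqsubseteq> z" "y \<sqsubseteq> z"
    using D xy unfolding directed_in_def by blast
  then show "\<exists>w\<in>f ` D. u \<sqsubseteq> w \<and> v \<sqsubseteq> w"
    using xy mono by (intro bexI[of _ "f z"]) simp_all
qed (use D f in \<open>auto simp: directed_in_def\<close>)

section \<open>The least element above a point closed under a family of operators\<close>

lemma
  assumes "x \<in> carrier L"
  shows aco_sup_closed: "aco_sup L \<Phi> x \<in> carrier L"
    and aco_sup_extensive: "x \<sqsubseteq> aco_sup L \<Phi> x"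
    and aco_sup_lower: "\<And>y. y \<in> carrier L \<Longrightarrow> x \<sqsubseteq> y \<Longrightarrow> (\<And>\<phi>. \<phi> \<in> \<Phi> \<Longrightarrow> \<phi> y \<sqsubseteq> y)
      \<Longrightarrow> aco_sup L \<Phi> x \<sqsubseteq> y"
  using assms unfolding aco_sup_def
  by (simp_all add: inf_closed inf_lower subset_iff) (intro inf_greatest; simp add: subset_iff)

text \<open>The Knaster-Tarski argument: by monotonicity, \<phi> maps the infimum below
  \<open>\<phi> y\<close>, hence below \<open>y\<close>, for every closed \<open>y\<close> above
  \<open>x\<close>.\<close>

lemma aco_sup_invariant:
  assumes \<Phi>: "\<Phi> \<subseteq> carrier (aco L)" and \<phi>: "\<phi> \<in> \<Phi>" and x: "x \<in> carrier L"
  shows "\<phi> (aco_sup L \<Phi> x) \<sqsubseteq> aco_sup L \<Phi> x"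
proof -
  let ?Y = "{y \<in> carrier L. x \<sqsubseteq> y \<and> (\<forall>\<phi>\<in>\<Phi>. \<phi> y \<sqsubseteq> y)}"
  have s: "aco_sup L \<Phi> x = \<Sqinter>?Y" using x by (simp add: aco_sup_def)
  have \<phi>': "\<phi> \<in> carrier (aco L)" using \<Phi> \<phi> by blast
  have YL: "?Y \<subseteq> carrier L" by blast
  have "\<phi> (\<Sqinter>?Y) \<sqsubseteq> y" if y: "y \<in> ?Y" for y
  proof (rule le_trans)
    show "\<phi> (\<Sqinter>?Y) \<sqsubseteq> \<phi> y"
      using aco_mono[OF \<phi>' inf_closed[OF YL] _ inf_lower[OF YL y]] y by simp
    show "\<phi> y \<sqsubseteq> y" using y \<phi> by simp
  qed (use y in \<open>auto intro!: aco_closed[OF \<phi>'] inf_closed\<close>)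
  then show ?thesis
    unfolding s by (intro inf_greatest aco_closed[OF \<phi>'] inf_closed) auto
qed

text \<open>The value at \<open>y\<close> is closed under \<Phi> and lies above \<open>x\<close>, so
  it is one of the elements whose infimum is the value at \<open>x\<close>.\<close>

lemma aco_sup_mono:
  assumes \<Phi>: "\<Phi> \<subseteq> carrier (aco L)" and x: "x \<in> carrier L" and y: "y \<in> carrier L"
    and xy: "x \<sqsubseteq> y"
  shows "aco_sup L \<Phi> x \<sqsubseteq> aco_sup L \<Phi> y"
  using aco_sup_lower[OF x] aco_sup_closed[OF y] aco_sup_invariant[OF \<Phi> _ y]
    le_trans[OF xy aco_sup_extensive[OF y]] x y by simp

lemma aco_sup_closure_operator:
  assumes \<Phi>: "\<Phi> \<subseteq> carrier (aco L)"
  shows "closure_operator L (aco_sup L \<Phi>)"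
proof -
  have "aco_sup L \<Phi> (aco_sup L \<Phi> x) = aco_sup L \<Phi> x" if x: "x \<in> carrier L" for x
  proof (rule le_antisym)
    \<comment> \<open>The value at \<open>x\<close> is already closed under \<Phi>, hence a
      candidate in the infimum taken above itself.\<close>
    show "aco_sup L \<Phi> (aco_sup L \<Phi> x) \<sqsubseteq> aco_sup L \<Phi> x"
      using aco_sup_lower[OF aco_sup_closed[OF x] aco_sup_closed[OF x]]
        aco_sup_invariant[OF \<Phi> _ x] aco_sup_closed[OF x] by simp
  qed (use x in \<open>simp_all add: aco_sup_closed aco_sup_extensive\<close>)
  then show ?thesis
    unfolding closure_operator_def
    using aco_sup_closed aco_sup_extensive aco_sup_mono[OF \<Phi>] by simp
qed

end

section \<open>Finitary operators on an algebraic lattice\<close>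

context algebraic_lattice
begin

text \<open>Any family of compact elements with join \<open>x\<close> is contained in
  \<open>compacts_below M x\<close>. This replaces the unspecified family of
  \<open>join_of_compact\<close> by a canonical directed one.\<close>

lemma sup_compacts_below:
  assumes x: "x \<in> carrier M"
  shows "\<Squnion>(compacts_below M x) = x"
proof (rule le_antisym)
  have sub: "compacts_below M x \<subseteq> carrier M"
    by (auto simp: compacts_below_def dest: compact_closed)
  show "\<Squnion>(compacts_below M x) \<sqsubseteq> x"
    using x sub by (intro sup_least) (auto simp: compacts_below_def)
  obtain K where K: "K \<subseteq> compact_elements M" "x = \<Squnion>K" using join_of_compact[OF x] by blast
  have KM: "K \<subseteq> carrier M" using K by (auto dest: compact_closed)
  have "K \<subseteq> compacts_below M x"
    using K sup_upper[OF KM] by (auto simp: compacts_below_def)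
  then show "x \<sqsubseteq> \<Squnion>(compacts_below M x)"
    using sup_mono[OF _ sub] K by simp
  show "\<Squnion>(compacts_below M x) \<in> carrier M" using sub by simp
qed (fact x)

lemma le_if_compacts_le:
  assumes x: "x \<in> carrier M" and y: "y \<in> carrier M"
    and "\<And>k. k \<in> compact_elements M \<Longrightarrow> k \<sqsubseteq> x \<Longrightarrow> k \<sqsubseteq> y"
  shows "x \<sqsubseteq> y"
proof -
  have "\<Squnion>(compacts_below M x) \<sqsubseteq> y"
    using assms by (intro sup_least) (auto simp: compacts_below_def dest: compact_closed)
  then show ?thesis by (simp add: sup_compacts_below x)
qed

text \<open>Since \<phi> is finitary, it suffices to bound \<open>\<phi> k\<close> for compact
  \<open>k\<close> below the join. Such a \<open>k\<close> lies below a single \<open>d\<close> in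
  \<open>D\<close>, so \<open>\<phi> k\<close> is below \<open>\<phi> d\<close> and thus below some
  \<open>e\<close> in \<open>D\<close>. The members of \<open>D\<close> may fail to be closed one by
  one, as happens when \<open>D\<close> is indexed by finite subfamilies.\<close>

lemma aco_directed_sup_invariant:
  assumes \<phi>: "\<phi> \<in> carrier (aco M)" and D: "directed_in M D"
    and step: "\<And>d. d \<in> D \<Longrightarrow> \<exists>e\<in>D. \<phi> d \<sqsubseteq> e"
  shows "\<phi> (\<Squnion>D) \<sqsubseteq> \<Squnion>D"
proof -
  have DM: "D \<subseteq> carrier M" using D by (simp add: directed_in_def)
  have sD: "\<Squnion>D \<in> carrier M" using DM by simp
  have "\<phi> k \<sqsubseteq> \<Squnion>D" if k: "k \<in> compacts_below M (\<Squnion>D)" for k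
  proof -
    have k': "k \<in> compact_elements M" "k \<sqsubseteq> \<Squnion>D" using k by (auto simp: compacts_below_def)
    have kM: "k \<in> carrier M" using k' by (auto dest: compact_closed)
    obtain d where d: "d \<in> D" "k \<sqsubseteq> d" using compact_le_directed_sup[OF k'(1) D k'(2)] .
    obtain e where e: "e \<in> D" "\<phi> d \<sqsubseteq> e" using step d by blast
    have M: "d \<in> carrier M" "e \<in> carrier M" using d e DM by auto
    have "\<phi> k \<sqsubseteq> \<phi> d" using aco_mono[OF \<phi> kM M(1) d(2)] .
    also note e(2)
    also have "e \<sqsubseteq> \<Squnion>D" using sup_upper[OF DM e(1)] .
    finally show ?thesis using aco_closed[OF \<phi>] kM M sD by simp
  qed
  moreover have "\<phi> ` compacts_below M (\<Squnion>D) \<subseteq> carrier M"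
    using aco_closed[OF \<phi>] by (auto simp: compacts_below_def dest: compact_closed)
  ultimately show ?thesis
    unfolding aco_finitary[OF \<phi> sD] using sD by (intro sup_least) auto
qed

text \<open>Monotonicity already gives one half of the finitary equation, so only the other
  inequality remains as a premise.\<close>

lemma acoI:
  assumes f: "closure_operator M f" "f \<in> extensional (carrier M)"
    and le: "\<And>x. x \<in> carrier M \<Longrightarrow> f x \<sqsubseteq> \<Squnion>(f ` compacts_below M x)"
  shows "f \<in> carrier (aco M)"
proof -
  have cl: "f x \<in> carrier M" if "x \<in> carrier M" for x
    using f that by (auto simp: closure_operator_def)
  have "f x = \<Squnion>(f ` compacts_below M x)" if x: "x \<in> carrier M" for x
  proof (rule le_antisym)
    have "compacts_below M x \<subseteq> carrier M"
      by (auto simp: compacts_below_def dest: compact_closed)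
    then have sub: "f ` compacts_below M x \<subseteq> carrier M" using cl by auto
    then show "\<Squnion>(f ` compacts_below M x) \<in> carrier M" by simp
    show "\<Squnion>(f ` compacts_below M x) \<sqsubseteq> f x"
      using f(1) x cl[OF x] sub
      by (intro sup_least)
        (auto simp: compacts_below_def closure_operator_def dest!: compact_closed)
  qed (use le cl x in auto)
  then show ?thesis
    using f cl by (auto simp: carrier_aco finitary_def compacts_below_def PiE_def)
qed

text \<open>The join of the values at the compact elements below \<open>x\<close> is above
  \<open>x\<close> and closed under \<Phi>, so the least such element, the value at
  \<open>x\<close>, lies below it.\<close>

lemma aco_sup_in_aco:
  assumes \<Phi>: "\<Phi> \<subseteq> carrier (aco M)"
  shows "aco_sup M \<Phi> \<in> carrier (aco M)"
proof (rule acoI)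
  show "closure_operator M (aco_sup M \<Phi>)" using aco_sup_closure_operator[OF \<Phi>] .
  show "aco_sup M \<Phi> \<in> extensional (carrier M)" by (simp add: aco_sup_def)
  fix x assume x: "x \<in> carrier M"
  let ?D = "aco_sup M \<Phi> ` compacts_below M x"
  have CM: "compacts_below M x \<subseteq> carrier M"
    by (auto simp: compacts_below_def dest: compact_closed)
  have D: "directed_in M ?D"
    using CM by (intro directed_image directed_compacts_below x aco_sup_closed aco_sup_mono \<Phi>) auto
  have DM: "?D \<subseteq> carrier M" using D by (simp add: directed_in_def)
  have "k \<sqsubseteq> \<Squnion>?D" if k: "k \<in> compacts_below M x" for k
    using le_trans[OF aco_sup_extensive sup_upper[OF DM]] k CM DM aco_sup_closed
    by (meson imageI sup_closed subsetD)
  then have "\<Squnion>(compacts_below M x) \<sqsubseteq> \<Squnion>?D" using CM DM by (intro sup_least) auto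
  then have "x \<sqsubseteq> \<Squnion>?D" by (simp add: sup_compacts_below x)
  moreover have "\<phi> (\<Squnion>?D) \<sqsubseteq> \<Squnion>?D" if "\<phi> \<in> \<Phi>" for \<phi>
  proof (rule aco_directed_sup_invariant[OF _ D])
    show "\<phi> \<in> carrier (aco M)" using that \<Phi> by blast
    \<comment> \<open>Every \<open>d\<close> here is a value of \<open>aco_sup M \<Phi>\<close>,
      hence closed under \<phi>, and serves as its own \<open>e\<close>.\<close>
    show "\<exists>e\<in>?D. \<phi> d \<sqsubseteq> e" if "d \<in> ?D" for d
      using that aco_sup_invariant[OF \<Phi> \<open>\<phi> \<in> \<Phi>\<close>] CM
      by (intro bexI[of _ d]) (auto simp del: weak_refl)
  qed
  ultimately show "aco_sup M \<Phi> x \<sqsubseteq> \<Squnion>?D"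
    using DM by (intro aco_sup_lower x) auto
qed

section \<open>The complete lattice of algebraic closure operators\<close>

lemma aco_sup_lub:
  assumes \<Phi>: "\<Phi> \<subseteq> carrier (aco M)"
  shows "least (aco M) (aco_sup M \<Phi>) (Upper (aco M) \<Phi>)"
proof (rule least_UpperI)
  fix \<phi> assume \<phi>: "\<phi> \<in> \<Phi>"
  then have \<phi>': "\<phi> \<in> carrier (aco M)" using \<Phi> by blast
  \<comment> \<open>Apply \<phi> to \<open>x\<close> \<sqsubseteq> \<open>aco_sup M \<Phi> x\<close>
    and use that the larger element is closed under \<phi>.\<close>
  have "\<phi> x \<sqsubseteq> aco_sup M \<Phi> x" if x: "x \<in> carrier M" for x
    using le_trans[OF aco_mono[OF \<phi>' x aco_sup_closed[OF x] aco_sup_extensive[OF x]]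
        aco_sup_invariant[OF \<Phi> \<phi> x]] aco_closed[OF \<phi>'] aco_sup_closed[OF x] x by simp
  then show "\<phi> \<sqsubseteq>\<^bsub>aco M\<^esub> aco_sup M \<Phi>" by (simp add: le_aco)
next
  fix \<psi> assume "\<psi> \<in> Upper (aco M) \<Phi>"
  then have \<psi>: "\<psi> \<in> carrier (aco M)" and up: "\<And>\<phi>. \<phi> \<in> \<Phi> \<Longrightarrow> \<phi> \<sqsubseteq>\<^bsub>aco M\<^esub> \<psi>"
    using \<Phi> by (auto simp: Upper_def)
  \<comment> \<open>The element \<open>\<psi> x\<close> is a candidate in the infimum: \<phi> is
    below \<psi>, and \<psi> is idempotent.\<close>
  have "aco_sup M \<Phi> x \<sqsubseteq> \<psi> x" if x: "x \<in> carrier M" for x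
  proof (rule aco_sup_lower[OF x aco_closed[OF \<psi> x] aco_extensive[OF \<psi> x]])
    fix \<phi> assume "\<phi> \<in> \<Phi>"
    then have "\<phi> (\<psi> x) \<sqsubseteq> \<psi> (\<psi> x)" using up aco_closed[OF \<psi> x] by (auto simp: le_aco)
    then show "\<phi> (\<psi> x) \<sqsubseteq> \<psi> x" by (simp add: aco_idem[OF \<psi> x])
  qed
  then show "aco_sup M \<Phi> \<sqsubseteq>\<^bsub>aco M\<^esub> \<psi>" by (simp add: le_aco)
qed (use \<Phi> aco_sup_in_aco in auto)

lemma aco_partial_order: "partial_order (aco M)"
proof unfold_locales
  fix \<phi> \<psi> assume le: "\<phi> \<sqsubseteq>\<^bsub>aco M\<^esub> \<psi>" "\<psi> \<sqsubseteq>\<^bsub>aco M\<^esub> \<phi>"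
    and c: "\<phi> \<in> carrier (aco M)" "\<psi> \<in> carrier (aco M)"
  have "\<phi> x = \<psi> x" if "x \<in> carrier M" for x
    using le_antisym[of "\<phi> x" "\<psi> x"] le c that by (simp add: le_aco aco_closed)
  \<comment> \<open>Agreement on the carrier suffices because both maps are extensional.\<close>
  then have "\<phi> = \<psi>"
    using c by (intro PiE_ext[of _ "carrier M" "\<lambda>_. carrier M"]) (simp_all add: carrier_aco)
  then show "\<phi> .=\<^bsub>aco M\<^esub> \<psi>" by (simp add: aco_def)
next
  fix \<phi> \<psi> \<chi>
  assume "\<phi> \<sqsubseteq>\<^bsub>aco M\<^esub> \<psi>" "\<psi> \<sqsubseteq>\<^bsub>aco M\<^esub> \<chi>"
    "\<phi> \<in> carrier (aco M)" "\<psi> \<in> carrier (aco M)" "\<chi> \<in> carrier (aco M)"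
  then show "\<phi> \<sqsubseteq>\<^bsub>aco M\<^esub> \<chi>"
    unfolding le_aco by (meson le_trans aco_closed)
next
  fix \<phi> assume "\<phi> \<in> carrier (aco M)"
  then show "\<phi> \<sqsubseteq>\<^bsub>aco M\<^esub> \<phi>" by (simp add: le_aco aco_closed)
qed (simp_all add: aco_def)

lemma aco_complete_lattice: "complete_lattice (aco M)"
proof (rule partial_order.complete_latticeI[OF aco_partial_order])
  fix \<Phi> assume \<Phi>: "\<Phi> \<subseteq> carrier (aco M)"
  show "\<exists>s. least (aco M) s (Upper (aco M) \<Phi>)" using aco_sup_lub[OF \<Phi>] by blast
  \<comment> \<open>The infimum of \<Phi> is obtained as the supremum of its lower bounds, each
    member of \<Phi> being an upper bound of these.\<close>
  have sub: "Lower (aco M) \<Phi> \<subseteq> carrier (aco M)" by simp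
  note lub = aco_sup_lub[OF sub]
  have "greatest (aco M) (aco_sup M (Lower (aco M) \<Phi>)) (Lower (aco M) \<Phi>)"
  proof (rule greatest_LowerI)
    fix \<phi> assume "\<phi> \<in> \<Phi>"
    then show "aco_sup M (Lower (aco M) \<Phi>) \<sqsubseteq>\<^bsub>aco M\<^esub> \<phi>"
      using \<Phi> by (intro least_le[OF lub] Upper_memI) auto
  next
    fix \<psi> assume "\<psi> \<in> Lower (aco M) \<Phi>"
    then show "\<psi> \<sqsubseteq>\<^bsub>aco M\<^esub> aco_sup M (Lower (aco M) \<Phi>)"
      using least_Upper_above[OF lub _ sub] by blast
  qed (use \<Phi> lub in auto)
  then show "\<exists>i. greatest (aco M) i (Lower (aco M) \<Phi>)" by blast
qed

text \<open>The library supremum is a choice among least upper bounds; antisymmetry makes the choice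
  unique.\<close>

lemma sup_aco_eq:
  assumes "\<Phi> \<subseteq> carrier (aco M)"
  shows "\<Squnion>\<^bsub>aco M\<^esub>\<Phi> = aco_sup M \<Phi>"
  using partial_order.least_unique[OF aco_partial_order] aco_sup_lub[OF assms]
  unfolding sup_def by (metis someI)

section \<open>Step operators and their compactness\<close>

lemma step_operator_in_aco:
  assumes a: "a \<in> compact_elements M" and b: "b \<in> carrier M"
  shows "step_operator M a b \<in> carrier (aco M)"
proof (rule acoI)
  let ?t = "step_operator M a b"
  have aM: "a \<in> carrier M" using a by (rule compact_closed)
  have cl: "?t x \<in> carrier M" and ext: "x \<sqsubseteq> ?t x" if "x \<in> carrier M" for x
    using that b by (simp_all add: step_operator_def join_left)
  have idem: "?t (?t x) = ?t x" if x: "x \<in> carrier M" for x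
  proof (cases "a \<sqsubseteq> x")
    case True
    have "a \<sqsubseteq> x \<squnion> b" using le_trans[OF True join_left] x b aM by simp
    moreover have "x \<squnion> b \<squnion> b = x \<squnion> b"
      using x b by (intro le_antisym join_le[OF le_refl join_right] join_left) simp_all
    ultimately show ?thesis using True x b by (simp add: step_operator_def)
  qed (simp add: step_operator_def x)
  have mono: "?t x \<sqsubseteq> ?t y" if x: "x \<in> carrier M" and y: "y \<in> carrier M" and xy: "x \<sqsubseteq> y" for x y
  proof (cases "a \<sqsubseteq> x")
    case True
    then have "a \<sqsubseteq> y" using le_trans[OF True xy] aM x y by simp
    moreover have "x \<squnion> b \<sqsubseteq> y \<squnion> b"
      using le_trans[OF xy join_left] x y b by (intro join_le) (simp_all add: join_right)
    ultimately show ?thesis using True x y by (simp add: step_operator_def)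
  next
    case False
    then have "?t x = x" using x by (simp add: step_operator_def)
    then show ?thesis using le_trans[OF xy ext[OF y]] x y cl by simp
  qed
  show "closure_operator M ?t"
    unfolding closure_operator_def using cl ext idem mono by simp
  show "?t \<in> extensional (carrier M)" by (simp add: step_operator_def)
  fix x assume x: "x \<in> carrier M"
  let ?s = "\<Squnion>(?t ` compacts_below M x)"
  have CM: "compacts_below M x \<subseteq> carrier M"
    by (auto simp: compacts_below_def dest: compact_closed)
  then have tM: "?t ` compacts_below M x \<subseteq> carrier M" using cl by auto
  then have sM: "?s \<in> carrier M" by simp
  have tk: "?t k \<sqsubseteq> ?s" if "k \<in> compacts_below M x" for k
    using that by (intro sup_upper tM) auto
  have "k \<sqsubseteq> ?s" if "k \<in> compacts_below M x" for k
    using le_trans[OF ext tk[OF that]] that CM cl sM by (simp add: subset_iff)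
  then have "\<Squnion>(compacts_below M x) \<sqsubseteq> ?s" using CM sM by (intro sup_least) auto
  then have xs: "x \<sqsubseteq> ?s" by (simp add: sup_compacts_below x)
  show "?t x \<sqsubseteq> ?s"
  proof (cases "a \<sqsubseteq> x")
    case True
    \<comment> \<open>Compactness of \<open>a\<close> enters here: \<open>a\<close> itself is among
      the compact elements below \<open>x\<close>, so its image \<open>a \<squnion> b\<close> is one
      of the joined elements.\<close>
    then have "?t a \<sqsubseteq> ?s" using tk a by (simp add: compacts_below_def)
    then have "a \<squnion> b \<sqsubseteq> ?s" using aM by (simp add: step_operator_def)
    then have "b \<sqsubseteq> ?s" using le_trans[OF join_right[OF aM b]] aM b sM by simp
    then show ?thesis using True x b xs sM by (simp add: step_operator_def join_le)
  next
    case False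
    then show ?thesis using xs x by (simp add: step_operator_def)
  qed
qed

text \<open>Evaluate at \<open>a\<close> for one direction. Conversely, if \<open>a\<close>
  \<sqsubseteq> \<open>x\<close>, then \<open>b\<close> \<sqsubseteq> \<open>\<psi> a\<close>
  \<sqsubseteq> \<open>\<psi> x\<close> by monotonicity, and \<open>x\<close> \<sqsubseteq>
  \<open>\<psi> x\<close>.\<close>

lemma step_operator_le_iff:
  assumes a: "a \<in> carrier M" and b: "b \<in> carrier M" and \<psi>: "\<psi> \<in> carrier (aco M)"
  shows "step_operator M a b \<sqsubseteq>\<^bsub>aco M\<^esub> \<psi> \<longleftrightarrow> b \<sqsubseteq> \<psi> a"
proof
  assume "step_operator M a b \<sqsubseteq>\<^bsub>aco M\<^esub> \<psi>"
  then have "step_operator M a b a \<sqsubseteq> \<psi> a" using a by (simp add: le_aco)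
  then have "a \<squnion> b \<sqsubseteq> \<psi> a" using a by (simp add: step_operator_def)
  then show "b \<sqsubseteq> \<psi> a"
    using le_trans[OF join_right[OF a b]] a b aco_closed[OF \<psi> a] by simp
next
  assume le: "b \<sqsubseteq> \<psi> a"
  have "step_operator M a b x \<sqsubseteq> \<psi> x" if x: "x \<in> carrier M" for x
  proof (cases "a \<sqsubseteq> x")
    case True
    have "b \<sqsubseteq> \<psi> x"
      using le_trans[OF le aco_mono[OF \<psi> a x True]] aco_closed[OF \<psi>] a b x by simp
    then show ?thesis
      using True x b aco_extensive[OF \<psi> x] aco_closed[OF \<psi> x]
      by (simp add: step_operator_def join_le)
  qed (use x aco_extensive[OF \<psi> x] in \<open>simp add: step_operator_def\<close>)
  then show "step_operator M a b \<sqsubseteq>\<^bsub>aco M\<^esub> \<psi>" by (simp add: le_aco)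
qed

text \<open>The values at \<open>a\<close> for finite \<open>F\<close> form a directed set whose
  join is closed under \<Phi> and above \<open>a\<close>. This join therefore bounds
  \<open>aco_sup M \<Phi> a\<close>, and compactness of \<open>b\<close> singles out one
  \<open>F\<close>.\<close>

lemma compact_le_aco_sup:
  assumes \<Phi>: "\<Phi> \<subseteq> carrier (aco M)" and a: "a \<in> carrier M"
    and b: "b \<in> compact_elements M" and le: "b \<sqsubseteq> aco_sup M \<Phi> a"
  obtains F where "finite F" "F \<subseteq> \<Phi>" "b \<sqsubseteq> aco_sup M F a"
proof -
  define D where "D = (\<lambda>F. aco_sup M F a) ` {F. finite F \<and> F \<subseteq> \<Phi>}"
  have DM: "D \<subseteq> carrier M" unfolding D_def using aco_sup_closed[OF a] by auto
  have DI: "aco_sup M F a \<in> D" if "finite F" "F \<subseteq> \<Phi>" for F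
    using that by (auto simp: D_def)
  \<comment> \<open>The value for \<open>G\<close> is closed under \<open>G\<close>, in particular
    under \<open>F\<close>.\<close>
  have mono: "aco_sup M F a \<sqsubseteq> aco_sup M G a" if "F \<subseteq> G" "G \<subseteq> \<Phi>" for F G
    using that \<Phi> a
    by (intro aco_sup_lower aco_sup_closed aco_sup_extensive aco_sup_invariant) auto
  have D: "directed_in M D"
    unfolding directed_in_def
  proof (intro conjI ballI)
    show "D \<noteq> {}" using DI[of "{}"] by auto
    fix x y assume "x \<in> D" "y \<in> D"
    then obtain F G where "x = aco_sup M F a" "finite F" "F \<subseteq> \<Phi>"
      "y = aco_sup M G a" "finite G" "G \<subseteq> \<Phi>" by (auto simp: D_def)
    then show "\<exists>z\<in>D. x \<sqsubseteq> z \<and> y \<sqsubseteq> z"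
      using DI[of "F \<union> G"] mono[of F "F \<union> G"] mono[of G "F \<union> G"] by auto
  qed (fact DM)
  have inv: "\<phi> (\<Squnion>D) \<sqsubseteq> \<Squnion>D" if \<phi>: "\<phi> \<in> \<Phi>" for \<phi>
  proof (rule aco_directed_sup_invariant[OF _ D])
    show \<phi>': "\<phi> \<in> carrier (aco M)" using \<phi> \<Phi> by blast
    fix d assume "d \<in> D"
    then obtain F where F: "d = aco_sup M F a" "finite F" "F \<subseteq> \<Phi>" by (auto simp: D_def)
    \<comment> \<open>\<phi> need not belong to \<open>F\<close>, so \<open>d\<close> may not be
      closed under it; adjoining \<phi> gives a larger member of \<open>D\<close> that is.\<close>
    let ?e = "aco_sup M (insert \<phi> F) a"
    have "\<phi> d \<sqsubseteq> \<phi> ?e"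
      unfolding F(1)
      using aco_mono[OF \<phi>' aco_sup_closed[OF a] aco_sup_closed[OF a] mono[of F "insert \<phi> F"]] F \<phi>
      by (simp add: subset_insertI)
    also have "\<phi> ?e \<sqsubseteq> ?e"
      using F \<phi> \<Phi> a by (intro aco_sup_invariant) auto
    finally have "\<phi> d \<sqsubseteq> ?e"
      using F aco_closed[OF \<phi>'] aco_sup_closed[OF a] by simp
    then show "\<exists>e\<in>D. \<phi> d \<sqsubseteq> e" using DI[of "insert \<phi> F"] F \<phi> by (intro bexI) simp_all
  qed
  have "a \<sqsubseteq> \<Squnion>D"
    using le_trans[OF aco_sup_extensive[OF a] sup_upper[OF DM DI[of "{}"]]]
      a aco_sup_closed[OF a] DM by simp
  then have "aco_sup M \<Phi> a \<sqsubseteq> \<Squnion>D" using DM inv by (intro aco_sup_lower a) auto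
  then have "b \<sqsubseteq> \<Squnion>D"
    using le_trans[OF le] compact_closed[OF b] aco_sup_closed[OF a] DM by simp
  then obtain d where "d \<in> D" "b \<sqsubseteq> d" using compact_le_directed_sup[OF b D] by blast
  then show thesis using that by (auto simp: D_def)
qed

text \<open>By \<open>step_operator_le_iff\<close>, a comparison of the step operator with a
  supremum is one of \<open>b\<close> with the value of that supremum at \<open>a\<close>, so
  compactness of \<open>b\<close> transfers.\<close>

lemma step_operator_compact:
  assumes a: "a \<in> compact_elements M" and b: "b \<in> compact_elements M"
  shows "step_operator M a b \<in> compact_elements (aco M)"
proof -
  have M: "a \<in> carrier M" "b \<in> carrier M" using a b by (auto dest: compact_closed)
  have "\<exists>F. finite F \<and> F \<subseteq> \<Phi> \<and> step_operator M a b \<sqsubseteq>\<^bsub>aco M\<^esub> \<Squnion>\<^bsub>aco M\<^esub>F"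
    if \<Phi>: "\<Phi> \<subseteq> carrier (aco M)" and le: "step_operator M a b \<sqsubseteq>\<^bsub>aco M\<^esub> \<Squnion>\<^bsub>aco M\<^esub>\<Phi>" for \<Phi>
  proof -
    have "b \<sqsubseteq> aco_sup M \<Phi> a"
      using le step_operator_le_iff[OF M aco_sup_in_aco[OF \<Phi>]] by (simp add: sup_aco_eq[OF \<Phi>])
    then obtain F where F: "finite F" "F \<subseteq> \<Phi>" "b \<sqsubseteq> aco_sup M F a"
      using compact_le_aco_sup[OF \<Phi> M(1) b] by blast
    have F': "F \<subseteq> carrier (aco M)" using F \<Phi> by blast
    then have "step_operator M a b \<sqsubseteq>\<^bsub>aco M\<^esub> \<Squnion>\<^bsub>aco M\<^esub>F"
      using F(3) step_operator_le_iff[OF M aco_sup_in_aco[OF F']] by (simp add: sup_aco_eq[OF F'])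
    then show ?thesis using F by blast
  qed
  then show ?thesis
    using step_operator_in_aco[OF a M(2)] unfolding compact_elements_def by blast
qed

section \<open>Decomposition into step operators\<close>

lemma aco_join_of_steps:
  assumes \<phi>: "\<phi> \<in> carrier (aco M)"
  defines "K \<equiv> {step_operator M a b | a b.
    a \<in> compact_elements M \<and> b \<in> compact_elements M \<and> b \<sqsubseteq> \<phi> a}"
  shows "\<phi> = \<Squnion>\<^bsub>aco M\<^esub>K"
proof -
  interpret A: complete_lattice "aco M" by (rule aco_complete_lattice)
  have K: "K \<subseteq> carrier (aco M)"
    by (auto simp: K_def intro: step_operator_in_aco compact_closed)
  have S: "\<Squnion>\<^bsub>aco M\<^esub>K \<in> carrier (aco M)" using K by simp
  let ?s = "\<Squnion>\<^bsub>aco M\<^esub>K"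
  \<comment> \<open>By algebraicity it is enough to test compact \<open>b\<close> below
    \<open>\<phi> k\<close>; for each of these the operator \<open>step_operator M k b\<close>
    belongs to \<open>K\<close>, which forces \<open>b\<close> below \<open>?s k\<close>.\<close>
  have comp: "\<phi> k \<sqsubseteq> ?s k" if k: "k \<in> compact_elements M" for k
  proof (rule le_if_compacts_le)
    have kM: "k \<in> carrier M" using k by (rule compact_closed)
    show "\<phi> k \<in> carrier M" "?s k \<in> carrier M" by (simp_all add: aco_closed \<phi> S kM)
    fix b assume b: "b \<in> compact_elements M" "b \<sqsubseteq> \<phi> k"
    then have "step_operator M k b \<sqsubseteq>\<^bsub>aco M\<^esub> ?s"
      using k by (intro A.sup_upper K) (unfold K_def, blast)
    then show "b \<sqsubseteq> ?s k"
      using step_operator_le_iff[OF kM compact_closed[OF b(1)] S] by simp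
  qed
  \<comment> \<open>As \<phi> is finitary, the inequality at compact elements extends to all
    \<open>x\<close>.\<close>
  have "\<phi> x \<sqsubseteq> ?s x" if x: "x \<in> carrier M" for x
    unfolding aco_finitary[OF \<phi> x]
  proof (rule sup_least)
    show "\<phi> ` compacts_below M x \<subseteq> carrier M"
      using aco_closed[OF \<phi>] by (auto simp: compacts_below_def dest: compact_closed)
    show "?s x \<in> carrier M" using aco_closed[OF S x] .
    fix y assume "y \<in> \<phi> ` compacts_below M x"
    then obtain k where k: "y = \<phi> k" "k \<in> compact_elements M" "k \<sqsubseteq> x"
      by (auto simp: compacts_below_def)
    have kM: "k \<in> carrier M" using k by (auto dest: compact_closed)
    show "y \<sqsubseteq> ?s x"
      using le_trans[OF comp[OF k(2)] aco_mono[OF S kM x k(3)]] k aco_closed[OF S]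
        aco_closed[OF \<phi>] kM x by simp
  qed
  then have "\<phi> \<sqsubseteq>\<^bsub>aco M\<^esub> ?s" by (simp add: le_aco)
  moreover have "?s \<sqsubseteq>\<^bsub>aco M\<^esub> \<phi>"
  proof (rule A.sup_least[OF K \<phi>])
    fix \<psi> assume "\<psi> \<in> K"
    then obtain a b where "\<psi> = step_operator M a b" "a \<in> compact_elements M"
      "b \<in> compact_elements M" "b \<sqsubseteq> \<phi> a" unfolding K_def by blast
    then show "\<psi> \<sqsubseteq>\<^bsub>aco M\<^esub> \<phi>"
      using step_operator_le_iff[OF _ _ \<phi>] compact_closed by metis
  qed
  ultimately show ?thesis using A.le_antisym \<phi> S by simp
qed

end

theorem theorem4p8:
  fixes L :: "('a, 'b) gorder_scheme"
  assumes "algebraic_lattice L"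
  shows "algebraic_lattice (aco L)"
proof -
  interpret algebraic_lattice L by fact
  interpret A: complete_lattice "aco L" by (rule aco_complete_lattice)
  show ?thesis
  proof unfold_locales
    fix \<phi> assume \<phi>: "\<phi> \<in> carrier (aco L)"
    \<comment> \<open>The witness is the family of step operators below \<phi> with compact
      parameters.\<close>
    show "\<exists>K. K \<subseteq> compact_elements (aco L) \<and> \<phi> = \<Squnion>\<^bsub>aco L\<^esub>K"
      using step_operator_compact
      by (subst aco_join_of_steps[OF \<phi>]) (intro exI conjI refl, auto)
  qed
qed

end
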